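(* Let $k$ be a positive integer and suppose that for every $i$ with $1\leq i\leq k$, every signed graph in $\mathcal{SP}_{i+1}$ admits a homomorphism to $SPC(i)$. Let $l\leq k$ be a positive integer and let $\hat B$ be a signed graph such that every signed graph in $\mathcal{SP}_{l}$ admits a homomorphism to $\hat B$. Then every signed graph in $\mathcal{SP}_{l+1}$ admits a homomorphism to $EDC(\hat B)$.
   Context: A signed graph $(G,\sigma)$ is a graph $G$ with $\sigma:E(G)\to\{+,-\}$ (at most one edge of each sign between two vertices). Switching at a vertex set $X$ multiplies by $-1$ the signs of edges with exactly one end in $X$. The sign of a closed walk is the product of its edge signs with multiplicity. A homomorphism $(G,\sigma)\to(H,\pi)$ is a mapping of vertices and edges preserving adjacencies, incidences and signs of closed walks; equivalently, a switching $\sigma'$ of $\sigma$ and a mapping preserving adjacencies, incidences and edge signs with respect to $\sigma'$ and $\pi$. For $i,j\in\{0,1\}$, $g_{ij}(G,\sigma)$ is the length of a shortest closed walk whose number of negative edges has parity $i$ and whose length has parity $j$ ($\infty$ if none). $C_{-m}$ denotes a cycle of length $m$ with an odd number of negative edges. $\mathcal{SP}_m$ is the class of signed planar graphs $(G,\sigma)$ with $g_{ij}(G,\sigma)\ge g_{ij}(C_{-m})$ for all $i,j\in\{0,1\}$. $SPC(i)$ is the signed graph on $\mathbb{Z}_2^i$ where $x,y$ are joined by a positive edge iff $x-y$ is a standard basis vector and by a negative edge iff $x-y$ is the all-ones vector. $EDC(\hat B)$, the extended double cover, has two vertices $x_0,x_1$ for each vertex $x$ of $\hat B$ joined by a negative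 edge; each positive edge $xy$ of $\hat B$ yields positive edges $x_0y_0,x_1y_1$; each negative edge $xy$ of $\hat B$ yields positive edges $x_0y_1,x_1y_0$; no other edges. *)

theory Defs
  imports "HOL-Analysis.Analysis" "HOL-Library.Extended_Nat" "HOL-Library.Z2"
begin

datatype sign = Pos | Neg

primrec sign_val :: "sign \<Rightarrow> int" where
  "sign_val Pos = 1"
| "sign_val Neg = -1"

text \<open>
  An edge is determined by its set of ends (a singleton for a loop) and its sign, so there is
  at most one edge of each sign between two vertices. Loops are allowed; they are needed for
  the class \<open>SP 1\<close>, because the negative cycle of length 1 is a negative loop.
\<close>

record 'a sgraph =
  verts :: "'a set"
  edges :: "('a set \<times> sign) set"

abbreviation ends :: "'a set \<times> sign \<Rightarrow> 'a set" where
  "ends \<equiv> fst"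

abbreviation edge_sign :: "'a set \<times> sign \<Rightarrow> sign" where
  "edge_sign \<equiv> snd"

definition signed_graph :: "'a sgraph \<Rightarrow> bool" where
  "signed_graph G \<longleftrightarrow>
     finite (verts G) \<and> (\<forall>e\<in>edges G. \<exists>x\<in>verts G. \<exists>y\<in>verts G. ends e = {x, y})"

text \<open>
  A walk is given by its first vertex and its list of edges; these determine the later vertices.
\<close>

primrec walk :: "'a sgraph \<Rightarrow> 'a \<Rightarrow> ('a set \<times> sign) list \<Rightarrow> 'a \<Rightarrow> bool" where
  "walk G x [] y \<longleftrightarrow> x \<in> verts G \<and> x = y"
| "walk G x (e # es) y \<longleftrightarrow> e \<in> edges G \<and> (\<exists>z. ends e = {x, z} \<and> walk G z es y)"

definition closed_walk :: "'a sgraph \<Rightarrow> ('a set \<times> sign) list \<Rightarrow> bool" where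
  "closed_walk G es \<longleftrightarrow> (\<exists>x. walk G x es x)"

definition walk_sign :: "('a set \<times> sign) list \<Rightarrow> int" where
  "walk_sign es = (\<Prod>e\<leftarrow>es. sign_val (edge_sign e))"

definition num_neg :: "('a set \<times> sign) list \<Rightarrow> nat" where
  "num_neg es = length (filter (\<lambda>e. edge_sign e = Neg) es)"

definition admits_hom :: "'a sgraph \<Rightarrow> 'b sgraph \<Rightarrow> bool" where
  "admits_hom G H \<longleftrightarrow>
     (\<exists>(f :: 'a \<Rightarrow> 'b) (h :: 'a set \<times> sign \<Rightarrow> 'b set \<times> sign).
        (\<forall>x\<in>verts G. f x \<in> verts H) \<and>
        (\<forall>e\<in>edges G. h e \<in> edges H \<and> ends (h e) = f ` ends e) \<and>
        (\<forall>es. closed_walk G es \<longrightarrow> walk_sign (map h es) = walk_sign es))"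

text \<open>The infimum of the empty set in \<^typ>\<open>enat\<close> is \<open>\<infinity>\<close>.\<close>

definition girth :: "nat \<Rightarrow> nat \<Rightarrow> 'a sgraph \<Rightarrow> enat" where
  "girth i j G =
     (INF es \<in> {es. closed_walk G es \<and> num_neg es mod 2 = i \<and> length es mod 2 = j}.
        enat (length es))"

text \<open>
  The representative with exactly one negative edge. For \<open>m = 1\<close> it is a negative loop and for
  \<open>m = 2\<close> a positive and a negative edge in parallel. Any other choice of an odd number of
  negative edges gives a switching equivalent signature, hence the same values of \<^const>\<open>girth\<close>.
\<close>

definition neg_cycle :: "nat \<Rightarrow> nat sgraph" where
  "neg_cycle m =
     \<lparr>verts = {..<m},
      edges = {({i, Suc i mod m}, if Suc i = m then Neg else Pos) | i. i < m}\<rparr>"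

text \<open>
  A drawing in the plane: distinct vertices are distinct points, an edge with two distinct ends
  is an arc and a loop is a simple closed curve (\<^const>\<open>simple_path\<close> covers both); edges meet
  vertices and each other only in common ends.
\<close>

definition planar :: "'a sgraph \<Rightarrow> bool" where
  "planar G \<longleftrightarrow>
     (\<exists>(p :: 'a \<Rightarrow> complex) (\<gamma> :: 'a set \<times> sign \<Rightarrow> real \<Rightarrow> complex).
        inj_on p (verts G) \<and>
        (\<forall>e\<in>edges G. simple_path (\<gamma> e) \<and>
           {pathstart (\<gamma> e), pathfinish (\<gamma> e)} = p ` ends e \<and>
           path_image (\<gamma> e) \<inter> p ` verts G = p ` ends e) \<and>
        (\<forall>e\<in>edges G. \<forall>e'\<in>edges G. e \<noteq> e' \<longrightarrow>
           path_image (\<gamma> e) \<inter> path_image (\<gamma> e') = p ` (ends e \<inter> ends e')))"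

definition SP :: "nat \<Rightarrow> 'a sgraph \<Rightarrow> bool" where
  "SP m G \<longleftrightarrow> signed_graph G \<and> planar G \<and>
     (\<forall>i\<in>{0, 1}. \<forall>j\<in>{0, 1}. girth i j G \<ge> girth i j (neg_cycle m))"

text \<open>Vectors over the two-element field with \<open>i\<close> coordinates are functions vanishing from \<open>i\<close> on.\<close>

definition SPC :: "nat \<Rightarrow> (nat \<Rightarrow> bit) sgraph" where
  "SPC i =
     (let V = {x. \<forall>n\<ge>i. x n = 0} in
      \<lparr>verts = V,
       edges =
         {({x, y}, Pos) | x y. x \<in> V \<and> y \<in> V \<and>
            (\<exists>j<i. (\<lambda>n. x n - y n) = (\<lambda>n. if n = j then 1 else 0))} \<union>
         {({x, y}, Neg) | x y. x \<in> V \<and> y \<in> V \<and>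
            (\<lambda>n. x n - y n) = (\<lambda>n. if n < i then 1 else 0)}\<rparr>)"

definition EDC :: "'a sgraph \<Rightarrow> ('a \<times> bit) sgraph" where
  "EDC B =
     \<lparr>verts = verts B \<times> UNIV,
      edges =
        {({(x, 0), (x, 1)}, Neg) | x. x \<in> verts B} \<union>
        {({(x, a), (y, a)}, Pos) | x y a. ({x, y}, Pos) \<in> edges B} \<union>
        {({(x, a), (y, a + 1)}, Pos) | x y a. ({x, y}, Neg) \<in> edges B}\<rparr>"

end

theory Submission
  imports Defs "HOL-Complex_Analysis.Riemann_Mapping"
begin

text \<open>
  A homomorphism of \<open>(G, \<sigma>)\<close> to \<open>SPC l\<close> sorts the edges of \<open>G\<close> into \<open>l + 1\<close> classes: the set \<open>J\<close> of
  edges with negative image and the \<open>l\<close> coordinate directions. A closed walk of \<open>G\<close> contains edges of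
  every class with one and the same parity, namely the parity of its number of negative edges.
  Contract \<open>J\<close> and let the edges in direction \<open>0\<close> be negative: a negative closed walk of the
  contraction then contains every remaining class an odd number of times, so its length is at least
  \<open>l\<close> and congruent to \<open>l\<close> modulo 2, while positive closed walks have even length. The contraction is
  planar, hence lies in \<open>\<S>\<P>\<^sub>l\<close> and maps to \<open>B\<close>. Pulling this map back to \<open>G\<close>, a closed walk contains
  an even number of edges that either are in \<open>J\<close> or have a negative image in \<open>B\<close>; hence there is a
  two-valued potential changing exactly along these edges, and it is the index of the copy in
  \<open>EDC B\<close>.

  Planarity of the contraction: the complement of an arc in the sphere is simply connected, so by
  the Riemann mapping theorem it is homeomorphic to the plane. Passing to one-point
  compactifications gives a continuous map of the sphere that collapses the arc to a point and is
  injective elsewhere; apply it to the drawing, one arc at a time.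
\<close>

section \<open>Collapsing an arc of the plane\<close>

text \<open>\<open>U\<close> is the complement of the arc in the sphere, seen from the end \<open>0\<close> of the arc.\<close>

lemma inverse_arc_complement:
  fixes \<gamma> :: "real \<Rightarrow> complex"
  assumes arc: "arc \<gamma>" and start: "\<gamma> 0 = 0"
  defines "U \<equiv> insert 0 (inverse ` (- path_image \<gamma>))"
  shows "open U" "simply_connected U"
proof -
  let ?K = "path_image \<gamma>"
  have K0: "0 \<in> ?K"
    using start by (auto simp: path_image_def intro!: image_eqI[of _ _ "0::real"])
  have "bounded ?K"
    using arc by (simp add: bounded_arc_image)
  then obtain R where R: "R > 0" "\<And>z. z \<in> ?K \<Longrightarrow> norm z \<le> R"
    unfolding bounded_pos by blast
  have inv_eq: "inverse ` (- ?K) = {w \<in> - {0}. inverse w \<in> - ?K}"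
    using K0 by (auto intro!: image_eqI[of _ _ "inverse _"])
  have ball: "w \<in> inverse ` (- ?K)" if "w \<in> ball 0 (1 / R)" "w \<noteq> 0" for w
  proof -
    have "norm (inverse w) > R"
      using that R(1) by (simp add: norm_inverse norm_divide field_simps)
    then have "inverse w \<notin> ?K" using R(2) by fastforce
    then show ?thesis using that inv_eq by auto
  qed
  \<comment> \<open>The arc is bounded, so every nonzero point close to 0 is the inverse of a point
    off the arc. Thus \<open>U\<close> contains a full disc around 0, the image of infinity, and
    this union yields both openness and connectedness.\<close>
  have U_eq: "U = inverse ` (- ?K) \<union> ball 0 (1 / R)"
  proof -
    have "0 \<in> ball (0::complex) (1 / R)" using R(1) by simp
    then show ?thesis unfolding U_def using ball by blast
  qed
  have "open (- {0::complex} \<inter> inverse -` (- ?K))"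
  proof (rule continuous_open_preimage)
    show "continuous_on (- {0::complex}) inverse"
      by (intro continuous_intros) auto
    show "open (- ?K)"
      using arc by (simp add: closed_arc_image open_Compl)
  qed auto
  then have "open (inverse ` (- ?K))"
    unfolding inv_eq by (simp add: Int_def vimage_def)
  then show "open U"
    unfolding U_eq by (intro open_Un) auto
  have "connected (- ?K)"
    using arc by (simp add: connected_arc_complement)
  then have "connected (inverse ` (- ?K))"
    using K0 by (intro connected_continuous_image continuous_intros) auto
  moreover have "of_real (1 / (2 * R)) \<in> inverse ` (- ?K) \<inter> ball 0 (1 / R)"
    using R(1) by (intro IntI ball) (simp_all add: norm_divide norm_mult field_simps)
  ultimately have con: "connected U"
    unfolding U_eq by (intro connected_Un connected_ball) auto
  have inj: "inj_on \<gamma> {0..1}" and cont: "continuous_on {0..1} \<gamma>"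
    using arc by (auto simp: arc_def path_def)
  have nz: "\<gamma> t \<noteq> 0" if "t \<in> {0<..1}" for t
    using inj_onD[OF inj, of t 0] that start by auto
  have K_minus: "?K - {0} = \<gamma> ` {0<..1}"
  proof
    show "?K - {0} \<subseteq> \<gamma> ` {0<..1}"
    proof
      fix z assume "z \<in> ?K - {0}"
      then obtain t where t: "t \<in> {0..1}" "z = \<gamma> t" "z \<noteq> 0"
        by (auto simp: path_image_def)
      then have "t \<noteq> 0" using start by metis
      with t show "z \<in> \<gamma> ` {0<..1}" by auto
    qed
    show "\<gamma> ` {0<..1} \<subseteq> ?K - {0}"
      using nz by (auto simp: path_image_def)
  qed
  \<comment> \<open>What \<open>U\<close> omits is the inverted arc without its end 0. It is
    connected, and unbounded because the arc runs into 0. Hence the complement of \<open>U\<close>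
    has no bounded component, which for an open connected plane set means simple
    connectivity.\<close>
  have compl: "- U = inverse ` \<gamma> ` {0<..1}"
  proof -
    have "- U = inverse ` (?K - {0})"
      unfolding U_def inv_eq by (auto intro!: image_eqI[of _ _ "inverse _"])
    then show ?thesis by (simp add: K_minus)
  qed
  have cont': "continuous_on {0<..1} \<gamma>"
    using cont by (rule continuous_on_subset) auto
  have "connected (- U)"
    unfolding compl using nz
    by (intro connected_continuous_image continuous_intros cont') auto
  moreover have "\<not> bounded (- U)"
  proof
    assume "bounded (- U)"
    then obtain b where b: "b > 0" "\<And>w. w \<in> - U \<Longrightarrow> norm w \<le> b"
      unfolding bounded_pos by blast
    have "(\<gamma> \<longlongrightarrow> \<gamma> 0) (at 0 within {0..1})"
      using cont by (simp add: continuous_on_def)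
    then have "eventually (\<lambda>t. dist (\<gamma> t) (\<gamma> 0) < 1 / b) (at 0 within {0..1})"
      using b(1) by (intro tendstoD) auto
    then obtain d where d: "d > 0"
      "\<And>t. t \<in> {0..1} \<Longrightarrow> t \<noteq> 0 \<Longrightarrow> dist t 0 < d \<Longrightarrow> dist (\<gamma> t) (\<gamma> 0) < 1 / b"
      unfolding eventually_at by blast
    define t where "t = min 1 (d / 2)"
    have t: "t \<in> {0<..1}" "dist t 0 < d" using d(1) by (auto simp: t_def)
    then have "norm (\<gamma> t) < 1 / b" using d(2)[of t] start by auto
    moreover have "norm (inverse (\<gamma> t)) \<le> b"
      using b(2) t unfolding compl by blast
    ultimately show False
      using nz[OF t(1)] b(1) by (simp add: norm_inverse norm_divide field_simps)
  qed
  moreover have "- U \<noteq> {}"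
    unfolding compl by auto
  ultimately have "\<forall>C \<in> components (- U). \<not> bounded C"
    using connected_eq_components_subset_sing[of "- U"] by blast
  then show "simply_connected U"
    using con by (simp add: simply_connected_eq_unbounded_complement_components[OF \<open>open U\<close>])
qed

text \<open>By the Riemann mapping theorem \<open>U\<close> is homeomorphic to a disc, hence to the
  whole plane. This homeomorphism, placed between two inversions, gives \<open>Q\<close>; only
  continuity at the points of the arc needs an estimate.\<close>

lemma collapse_arc_from_0:
  fixes \<gamma> :: "real \<Rightarrow> complex"
  assumes arc: "arc \<gamma>" and start: "\<gamma> 0 = 0"
  shows "\<exists>Q :: complex \<Rightarrow> complex. continuous_on UNIV Q \<and> (\<forall>z. Q z = 0 \<longleftrightarrow> z \<in> path_image \<gamma>) \<and>
           inj_on Q (- path_image \<gamma>)"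
proof -
  let ?K = "path_image \<gamma>"
  define U where "U = insert 0 (inverse ` (- ?K))"
  have U: "open U" "simply_connected U"
    using inverse_arc_complement[OF assms] by (simp_all add: U_def)
  have K0: "0 \<in> ?K"
    using start by (auto simp: path_image_def intro!: image_eqI[of _ _ "0::real"])
  have "U homeomorphic ball (0::complex) 1"
    using U simply_connected_eq_homeomorphic_to_disc[of U] by (auto simp: U_def)
  then have "U homeomorphic (UNIV :: complex set)"
    using homeomorphic_ball_UNIV[of 1 "0::complex"] homeomorphic_trans by auto
  then obtain g g' :: "complex \<Rightarrow> complex" where hom: "homeomorphism U UNIV g g'"
    by (auto simp: homeomorphic_def)
  have g: "continuous_on U g" "continuous_on UNIV g'" "\<And>w. w \<in> U \<Longrightarrow> g' (g w) = w"
    "\<And>v. g (g' v) = v" "\<And>v. g' v \<in> U"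
    using hom by (auto simp: homeomorphism_def)
  have inj_g: "inj_on g U"
    using g(3) by (metis inj_on_inverseI)
  have inU: "inverse z \<in> U" if "z \<notin> ?K" for z
    using that by (auto simp: U_def)
  have notinU: "inverse z \<notin> U" if "z \<in> ?K" "z \<noteq> 0" for z
    using that by (auto simp: U_def)
  have nz: "g (inverse z) \<noteq> g 0" if "z \<notin> ?K" for z
  proof
    assume "g (inverse z) = g 0"
    then have "inverse z = 0" using inj_onD[OF inj_g, of "inverse z" 0] inU[OF that] by (simp add: U_def)
    then show False using that K0 by auto
  qed
  \<comment> \<open>\<open>g\<close> sends the arc to infinity and the point at infinity to \<open>g 0\<close>; the outer inversion moves
    the arc to \<open>0\<close> and \<open>g 0\<close> to infinity.\<close>
  define Q where "Q = (\<lambda>z. if z \<in> ?K then 0 else inverse (g (inverse z) - g 0))"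
  have zero: "Q z = 0 \<longleftrightarrow> z \<in> ?K" for z
    using nz by (auto simp: Q_def)
  have inj: "inj_on Q (- ?K)"
  proof (rule inj_onI)
    fix x y assume xy: "x \<in> - ?K" "y \<in> - ?K" "Q x = Q y"
    then have "g (inverse x) = g (inverse y)" by (auto simp: Q_def)
    moreover have "inverse x \<in> U" "inverse y \<in> U" using xy inU by auto
    ultimately have "inverse x = inverse y" by (rule inj_onD[OF inj_g])
    then show "x = y" by simp
  qed
  have open_K: "open (- ?K)"
    using arc by (simp add: closed_arc_image open_Compl)
  have "isCont Q z0" for z0
  proof (cases "z0 \<in> ?K")
    case False
    have "continuous_on (- ?K) (\<lambda>z. inverse (g (inverse z) - g 0))"
      using inU nz K0
      by (intro continuous_intros continuous_on_compose2[OF g(1), of "- ?K" inverse]) auto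
    then have "continuous_on (- ?K) Q"
      by (rule continuous_on_eq) (auto simp: Q_def)
    then show ?thesis
      using False open_K by (simp add: continuous_on_eq_continuous_at)
  next
    case True
    show ?thesis
      unfolding continuous_at_eps_delta
    proof (intro allI impI)
      fix e :: real assume e: "e > 0"
      \<comment> \<open>For \<open>z\<close> off the arc, \<open>Q z\<close> has norm below
        \<open>e\<close> exactly when \<open>g (inverse z)\<close> lies outside this closed ball,
        that is, when \<open>inverse z\<close> is not in \<open>C\<close>. As \<open>C\<close> is a
        compact part of \<open>U\<close>, its inverses keep away from the arc.\<close>
      define C where "C = g' ` cball (g 0) (1 / e)"
      have "compact C"
        unfolding C_def by (intro compact_continuous_image continuous_on_subset[OF g(2)]) auto
      obtain M where M: "M > 0" "\<And>w. w \<in> C \<Longrightarrow> norm w \<le> M"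
        using compact_imp_bounded[OF \<open>compact C\<close>] unfolding bounded_pos by blast
      \<comment> \<open>Since \<open>inverse 0 = 0\<close> by convention and 0 lies in
        \<open>C\<close>, the plain preimage of \<open>C\<close> would contain the point 0 of the
        arc. The norm bound cuts it out and loses no other point, because \<open>M\<close> bounds
        \<open>C\<close>.\<close>
      define D where "D = {z::complex. norm z \<ge> 1 / M} \<inter> inverse -` C"
      have "closed D"
        unfolding D_def
      proof (rule continuous_closed_preimage)
        show "continuous_on {z::complex. norm z \<ge> 1 / M} inverse"
          using M(1) by (intro continuous_intros) auto
        show "closed {z::complex. norm z \<ge> 1 / M}"
          by (intro closed_Collect_le continuous_intros)
        show "closed C"
          using \<open>compact C\<close> by (rule compact_imp_closed)
      qed
      moreover have "z0 \<notin> D"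
      proof
        assume "z0 \<in> D"
        then have "z0 \<noteq> 0" "inverse z0 \<in> U"
          using M(1) g(5) by (auto simp: D_def C_def)
        then show False using notinU True by blast
      qed
      ultimately obtain d where d: "d > 0" "ball z0 d \<subseteq> - D"
        by (metis ComplI open_Compl openE)
      show "\<exists>d>0. \<forall>z. dist z z0 < d \<longrightarrow> dist (Q z) (Q z0) < e"
      proof (intro exI[of _ d] conjI allI impI)
        show "d > 0" by fact
        fix z assume "dist z z0 < d"
        then have zD: "z \<notin> D" using d(2) by (auto simp: dist_commute)
        show "dist (Q z) (Q z0) < e"
        proof (cases "z \<in> ?K")
          case z: True
          then show ?thesis using True e by (simp add: Q_def)
        next
          case False
          then have "z \<noteq> 0" using K0 by auto
          have "inverse z \<notin> C"
          proof
            assume C: "inverse z \<in> C"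
            then have "norm (inverse z) \<le> M" by (rule M)
            then have "norm z \<ge> 1 / M"
              using \<open>z \<noteq> 0\<close> M(1) by (simp add: norm_inverse norm_divide field_simps)
            then show False using C zD by (simp add: D_def)
          qed
          then have "g (inverse z) \<notin> cball (g 0) (1 / e)"
            unfolding C_def using g(3)[OF inU[OF False]] by (metis image_eqI)
          then have "norm (g (inverse z) - g 0) > 1 / e"
            by (simp add: dist_norm norm_minus_commute)
          then have "inverse (norm (g (inverse z) - g 0)) < inverse (1 / e)"
            using e by (intro less_imp_inverse_less) auto
          then show ?thesis
            using False True by (simp add: Q_def norm_inverse)
        qed
      qed
    qed
  qed
  then have "continuous_on UNIV Q"
    by (simp add: continuous_at_imp_continuous_on)
  then show ?thesis using zero inj by blast
qed

lemma collapse_arc: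
  fixes \<gamma> :: "real \<Rightarrow> complex"
  assumes arc: "arc \<gamma>"
  obtains Q :: "complex \<Rightarrow> complex" where "continuous_on UNIV Q"
    "\<And>z. Q z = 0 \<longleftrightarrow> z \<in> path_image \<gamma>" "inj_on Q (- path_image \<gamma>)"
proof -
  define \<delta> where "\<delta> = (+) (- \<gamma> 0) \<circ> \<gamma>"
  have "arc \<delta>" "\<delta> 0 = 0"
    using arc by (simp_all add: \<delta>_def arc_translation_eq)
  then obtain Q :: "complex \<Rightarrow> complex" where Q: "continuous_on UNIV Q"
    "\<And>z. Q z = 0 \<longleftrightarrow> z \<in> path_image \<delta>" "inj_on Q (- path_image \<delta>)"
    using collapse_arc_from_0 by blast
  have im: "z - \<gamma> 0 \<in> path_image \<delta> \<longleftrightarrow> z \<in> path_image \<gamma>" for z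
    by (force simp: \<delta>_def path_image_def)
  show ?thesis
  proof
    show "continuous_on UNIV (\<lambda>z. Q (z - \<gamma> 0))"
      by (intro continuous_on_compose2[OF Q(1)] continuous_intros) auto
    show "Q (z - \<gamma> 0) = 0 \<longleftrightarrow> z \<in> path_image \<gamma>" for z
      by (simp add: Q(2) im)
    show "inj_on (\<lambda>z. Q (z - \<gamma> 0)) (- path_image \<gamma>)"
    proof (rule inj_onI)
      fix x y assume "x \<in> - path_image \<gamma>" "y \<in> - path_image \<gamma>" "Q (x - \<gamma> 0) = Q (y - \<gamma> 0)"
      then show "x = y" using inj_onD[OF Q(3), of "x - \<gamma> 0" "y - \<gamma> 0"] im by auto
    qed
  qed
qed

section \<open>Contraction of planar signed graphs\<close>

text \<open>
  Unlike in \<^const>\<open>planar\<close>, the map \<open>p\<close> need not be injective: contracting an edge identifies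
  the images of its ends and keeps the vertex set.
\<close>

definition drawing :: "('a \<Rightarrow> complex) \<Rightarrow> ('a set \<times> sign \<Rightarrow> real \<Rightarrow> complex) \<Rightarrow> 'a set \<Rightarrow> ('a set \<times> sign) set \<Rightarrow> bool" where
  "drawing p \<gamma> V D \<longleftrightarrow>
     (\<forall>e\<in>D. simple_path (\<gamma> e) \<and> {pathstart (\<gamma> e), pathfinish (\<gamma> e)} = p ` ends e \<and>
        path_image (\<gamma> e) \<inter> p ` V = p ` ends e) \<and>
     (\<forall>e\<in>D. \<forall>e'\<in>D. e \<noteq> e' \<longrightarrow> path_image (\<gamma> e) \<inter> path_image (\<gamma> e') = p ` ends e \<inter> p ` ends e')"

lemma drawing_subset: "drawing p \<gamma> V D \<Longrightarrow> D' \<subseteq> D \<Longrightarrow> drawing p \<gamma> V D'"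
  unfolding drawing_def by (meson subsetD)

text \<open>The path meets the collapsed set at most in its two ends, so \<open>Q\<close> can only
  identify these with each other: an arc may turn into a simple closed curve, and nothing worse
  happens.\<close>

lemma simple_path_collapse:
  assumes path: "simple_path \<gamma>" and contact: "path_image \<gamma> \<inter> K \<subseteq> {pathstart \<gamma>, pathfinish \<gamma>}"
    and Q: "continuous_on UNIV Q" "\<And>z. Q z = 0 \<longleftrightarrow> z \<in> K" "inj_on Q (- K)"
  shows "simple_path (Q \<circ> \<gamma>)"
proof -
  have inj: "x = y \<or> x = 0 \<and> y = 1 \<or> x = 1 \<and> y = 0"
    if "x \<in> {0..1}" "y \<in> {0..1}" "\<gamma> x = \<gamma> y" for x y
    using path that by (auto simp: simple_path_def loop_free_def)
  have ends: "x = 0 \<or> x = 1" if x: "x \<in> {0..1}" "\<gamma> x \<in> K" for x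
  proof -
    have "\<gamma> x \<in> path_image \<gamma>" using x by (auto simp: path_image_def)
    then have "\<gamma> x = \<gamma> 0 \<or> \<gamma> x = \<gamma> 1"
      using contact x(2) by (auto simp: pathstart_def pathfinish_def)
    then show ?thesis using inj[of x 0] inj[of x 1] x(1) by auto
  qed
  have "path (Q \<circ> \<gamma>)"
    using path continuous_on_subset[OF Q(1)] path_continuous_image
    by (auto simp: simple_path_def)
  moreover have "loop_free (Q \<circ> \<gamma>)"
    unfolding loop_free_def
  proof (intro ballI impI)
    fix x y :: real
    assume xy: "x \<in> {0..1}" "y \<in> {0..1}" "(Q \<circ> \<gamma>) x = (Q \<circ> \<gamma>) y"
    show "x = y \<or> x = 0 \<and> y = 1 \<or> x = 1 \<and> y = 0"
    proof (cases "\<gamma> x \<in> K")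
      case True
      then have "\<gamma> y \<in> K" using xy(3) Q(2) by (metis comp_apply)
      then show ?thesis using True ends xy by blast
    next
      case False
      then have "\<gamma> y \<notin> K" using xy(3) Q(2) by (metis comp_apply)
      then have "\<gamma> x = \<gamma> y" using False xy(3) inj_onD[OF Q(3)] by auto
      then show ?thesis using inj xy by blast
    qed
  qed
  ultimately show ?thesis by (simp add: simple_path_def)
qed

text \<open>\<open>Q\<close> identifies only points of the curve of \<open>e0\<close>, and every
  other edge meets that curve only in images of common ends. So each new coincidence of points takes
  place at the image of a vertex. The edge \<open>e0\<close> shrinks to a point and leaves the
  drawing.\<close>

lemma drawing_collapse:
  assumes dr: "drawing p \<gamma> V D" and e0: "e0 \<in> D" and V: "\<And>e. e \<in> D \<Longrightarrow> ends e \<subseteq> V"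
    and Q: "continuous_on UNIV Q" "\<And>z. Q z = 0 \<longleftrightarrow> z \<in> path_image (\<gamma> e0)"
      "inj_on Q (- path_image (\<gamma> e0))"
  shows "drawing (Q \<circ> p) (\<lambda>e. Q \<circ> \<gamma> e) V (D - {e0})"
proof -
  let ?K = "path_image (\<gamma> e0)"
  have sp: "simple_path (\<gamma> e)" and st: "{pathstart (\<gamma> e), pathfinish (\<gamma> e)} = p ` ends e"
    and im: "path_image (\<gamma> e) \<inter> p ` V = p ` ends e" if "e \<in> D" for e
    using dr that by (auto simp: drawing_def)
  have meet: "path_image (\<gamma> e) \<inter> path_image (\<gamma> e') = p ` ends e \<inter> p ` ends e'"
    if "e \<in> D" "e' \<in> D" "e \<noteq> e'" for e e'
    using dr that by (auto simp: drawing_def)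
  have sub: "p ` ends e \<subseteq> path_image (\<gamma> e)" if "e \<in> D" for e
    using im[OF that] by auto
  have subQ: "(Q \<circ> p) ` ends e \<subseteq> path_image (Q \<circ> \<gamma> e)" if "e \<in> D" for e
    using image_mono[OF sub[OF that], of Q] by (simp add: path_image_compose image_comp)
  have Q_eq: "z = w \<or> z \<in> ?K \<and> w \<in> ?K" if "Q z = Q w" for z w
    using that Q(2) inj_onD[OF Q(3), of z w] by (metis ComplI)
  have Q_const: "Q z = Q w" if "z \<in> ?K" "w \<in> ?K" for z w
    using that Q(2) by metis
  show ?thesis
    unfolding drawing_def
  proof (intro conjI ballI impI)
    fix e assume e: "e \<in> D - {e0}"
    then have eK: "path_image (\<gamma> e) \<inter> ?K = p ` ends e \<inter> p ` ends e0"
      using meet e0 by auto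
    show "simple_path (Q \<circ> \<gamma> e)"
      by (rule simple_path_collapse[OF _ _ Q]) (use e sp st eK in auto)
    show "{pathstart (Q \<circ> \<gamma> e), pathfinish (Q \<circ> \<gamma> e)} = (Q \<circ> p) ` ends e"
    proof -
      have "(Q \<circ> p) ` ends e = Q ` {pathstart (\<gamma> e), pathfinish (\<gamma> e)}"
        using st[of e] e by (simp add: image_comp)
      then show ?thesis by (simp add: pathstart_compose pathfinish_compose)
    qed
    show "path_image (Q \<circ> \<gamma> e) \<inter> (Q \<circ> p) ` V = (Q \<circ> p) ` ends e"
    proof
      show "(Q \<circ> p) ` ends e \<subseteq> path_image (Q \<circ> \<gamma> e) \<inter> (Q \<circ> p) ` V"
        using subQ[of e] image_mono[OF V[of e], of "Q \<circ> p"] e by blast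
      show "path_image (Q \<circ> \<gamma> e) \<inter> (Q \<circ> p) ` V \<subseteq> (Q \<circ> p) ` ends e"
      proof
        fix w assume "w \<in> path_image (Q \<circ> \<gamma> e) \<inter> (Q \<circ> p) ` V"
        then obtain z v where z: "z \<in> path_image (\<gamma> e)" "w = Q z" "v \<in> V" "Q z = Q (p v)"
          by (auto simp: path_image_compose)
        then consider "z = p v" | "z \<in> ?K" using Q_eq by blast
        then have "z \<in> p ` ends e"
        proof cases
          case 1
          then show ?thesis using z im[of e] e by auto
        next
          case 2
          then show ?thesis using z eK by auto
        qed
        then show "w \<in> (Q \<circ> p) ` ends e" using z(2) by auto
      qed
    qed
  next
    fix e e' assume e: "e \<in> D - {e0}" "e' \<in> D - {e0}" "e \<noteq> e'"
    have eK: "path_image (\<gamma> d) \<inter> ?K \<subseteq> p ` ends d" if "d \<in> D - {e0}" for d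
      using meet[of d e0] e0 that by auto
    show "path_image (Q \<circ> \<gamma> e) \<inter> path_image (Q \<circ> \<gamma> e') = (Q \<circ> p) ` ends e \<inter> (Q \<circ> p) ` ends e'"
    proof
      show "(Q \<circ> p) ` ends e \<inter> (Q \<circ> p) ` ends e' \<subseteq> path_image (Q \<circ> \<gamma> e) \<inter> path_image (Q \<circ> \<gamma> e')"
        using subQ[of e] subQ[of e'] e by blast
      show "path_image (Q \<circ> \<gamma> e) \<inter> path_image (Q \<circ> \<gamma> e') \<subseteq> (Q \<circ> p) ` ends e \<inter> (Q \<circ> p) ` ends e'"
      proof
        fix w assume "w \<in> path_image (Q \<circ> \<gamma> e) \<inter> path_image (Q \<circ> \<gamma> e')"
        then obtain z z' where z: "z \<in> path_image (\<gamma> e)" "z' \<in> path_image (\<gamma> e')" "w = Q z" "Q z = Q z'"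
          by (auto simp: path_image_compose)
        then consider "z = z'" | "z \<in> ?K" "z' \<in> ?K" using Q_eq by blast
        then have "z \<in> p ` ends e \<and> z' \<in> p ` ends e'"
        proof cases
          case 1
          then show ?thesis using z meet[of e e'] e by auto
        next
          case 2
          then show ?thesis using z eK e by blast
        qed
        then have "Q z \<in> Q ` p ` ends e" "Q z' \<in> Q ` p ` ends e'" by auto
        then show "w \<in> (Q \<circ> p) ` ends e \<inter> (Q \<circ> p) ` ends e'"
          using z by (auto simp: image_comp)
      qed
    qed
  qed
qed

section \<open>Walks, and identifying vertices along a set of edges\<close>

lemma walk_append: "walk G x es y \<Longrightarrow> walk G y fs z \<Longrightarrow> walk G x (es @ fs) z"
  by (induction es arbitrary: x) auto

lemma walk_edges: "walk G x es y \<Longrightarrow> set es \<subseteq> edges G"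
  by (induction es arbitrary: x) auto

lemma signed_graph_ends: "signed_graph G \<Longrightarrow> e \<in> edges G \<Longrightarrow> ends e \<subseteq> verts G"
  by (force simp: signed_graph_def)

lemma walk_verts: "signed_graph G \<Longrightarrow> walk G x es y \<Longrightarrow> x \<in> verts G \<and> y \<in> verts G"
  by (induction es arbitrary: x) (auto dest: signed_graph_ends)

lemma walk_rev: "signed_graph G \<Longrightarrow> walk G x es y \<Longrightarrow> walk G y (rev es) x"
proof (induction es arbitrary: x)
  case (Cons e es)
  then obtain z where z: "e \<in> edges G" "ends e = {x, z}" "walk G z es y" by auto
  then have "walk G z [e] x"
    using signed_graph_ends[OF Cons.prems(1) z(1)] by (auto simp: insert_commute)
  then show ?case using Cons.IH[OF Cons.prems(1) z(3)] walk_append by fastforce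
qed auto

text \<open>With the set of contracted edges as \<open>J\<close>, the classes of this relation are
  the vertices of the contraction; with \<open>UNIV\<close> they are the components of
  \<open>G\<close>.\<close>

definition reach :: "'a sgraph \<Rightarrow> ('a set \<times> sign) set \<Rightarrow> 'a \<Rightarrow> 'a \<Rightarrow> bool" where
  "reach G J x y \<longleftrightarrow> (\<exists>es. walk G x es y \<and> set es \<subseteq> J)"

lemma reach_refl: "x \<in> verts G \<Longrightarrow> reach G J x x"
  unfolding reach_def by (rule exI[of _ "[]"]) auto

lemma reach_trans: "reach G J x y \<Longrightarrow> reach G J y z \<Longrightarrow> reach G J x z"
  unfolding reach_def using walk_append by (metis Un_subset_iff set_append)

lemma reach_sym: "signed_graph G \<Longrightarrow> reach G J x y \<Longrightarrow> reach G J y x"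
  unfolding reach_def using walk_rev by (metis set_rev)

lemma reach_mono: "reach G J x y \<Longrightarrow> J \<subseteq> J' \<Longrightarrow> reach G J' x y"
  unfolding reach_def by blast

lemma reach_edge:
  "signed_graph G \<Longrightarrow> e \<in> edges G \<Longrightarrow> e \<in> J \<Longrightarrow> ends e = {x, y} \<Longrightarrow> reach G J x y"
  unfolding reach_def by (rule exI[of _ "[e]"]) (auto dest: signed_graph_ends)

lemma finite_edges:
  assumes "signed_graph G"
  shows "finite (edges G)"
proof (rule finite_subset)
  show "edges G \<subseteq> Pow (verts G) \<times> {Pos, Neg}"
  proof
    fix e assume "e \<in> edges G"
    then have "ends e \<subseteq> verts G" by (rule signed_graph_ends[OF assms])
    then show "e \<in> Pow (verts G) \<times> {Pos, Neg}" by (cases e; cases "snd e") auto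
  qed
  show "finite (Pow (verts G) \<times> {Pos, Neg})"
    using assms by (simp add: signed_graph_def)
qed

text \<open>Induction on \<open>F\<close>. An edge whose ends already share their place is a closed
  curve and is erased, which identifies no vertices; any other edge is an arc and is collapsed by
  \<open>collapse_arc\<close>. Throughout, two vertices share their place exactly when a walk inside
  \<open>F\<close> joins them.\<close>

lemma contract_drawing:
  assumes G: "signed_graph G" "planar G" and "finite F" "F \<subseteq> edges G"
  shows "\<exists>p \<gamma>. drawing p \<gamma> (verts G) (edges G - F) \<and>
      (\<forall>e\<in>F. \<forall>x\<in>ends e. \<forall>y\<in>ends e. p x = p y) \<and>
      (\<forall>x\<in>verts G. \<forall>y\<in>verts G. p x = p y \<longrightarrow> reach G F x y)"
  using assms(3,4)
proof (induction F)
  case empty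
  obtain p and \<gamma> :: "'a set \<times> sign \<Rightarrow> real \<Rightarrow> complex" where
    inj: "inj_on p (verts G)" and edge: "\<forall>e\<in>edges G. simple_path (\<gamma> e) \<and>
      {pathstart (\<gamma> e), pathfinish (\<gamma> e)} = p ` ends e \<and> path_image (\<gamma> e) \<inter> p ` verts G = p ` ends e" and
    meet: "\<forall>e\<in>edges G. \<forall>e'\<in>edges G. e \<noteq> e' \<longrightarrow>
      path_image (\<gamma> e) \<inter> path_image (\<gamma> e') = p ` (ends e \<inter> ends e')"
    using G(2) unfolding planar_def by blast
  have "drawing p \<gamma> (verts G) (edges G)"
    using edge meet inj_on_image_Int[OF inj] signed_graph_ends[OF G(1)]
    by (auto simp: drawing_def)
  then show ?case
    using reach_refl inj_onD[OF inj] by (metis Diff_empty empty_iff)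
next
  case (insert e0 F)
  then have "F \<subseteq> edges G" by auto
  from insert.IH[OF this] obtain p \<gamma> where dr: "drawing p \<gamma> (verts G) (edges G - F)"
    and IH: "\<forall>e\<in>F. \<forall>x\<in>ends e. \<forall>y\<in>ends e. p x = p y"
      "\<forall>x\<in>verts G. \<forall>y\<in>verts G. p x = p y \<longrightarrow> reach G F x y"
    by (elim exE conjE) (rule that)
  have const: "\<And>e x y. e \<in> F \<Longrightarrow> x \<in> ends e \<Longrightarrow> y \<in> ends e \<Longrightarrow> p x = p y"
    using IH(1) by blast
  have conn: "\<And>x y. x \<in> verts G \<Longrightarrow> y \<in> verts G \<Longrightarrow> p x = p y \<Longrightarrow> reach G F x y"
    using IH(2) by blast
  have e0: "e0 \<in> edges G" "e0 \<in> edges G - F" using insert by auto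
  have conn': "reach G (insert e0 F) x y" if "x \<in> verts G" "y \<in> verts G" "p x = p y" for x y
    by (rule reach_mono[OF conn[OF that]]) auto
  obtain u v where uv: "ends e0 = {u, v}" "u \<in> verts G" "v \<in> verts G"
    using G(1) e0(1) unfolding signed_graph_def by blast
  have diff: "edges G - insert e0 F = edges G - F - {e0}" by auto
  show ?case
  proof (cases "p u = p v")
    case True
    have "drawing p \<gamma> (verts G) (edges G - insert e0 F)"
      using dr by (rule drawing_subset) auto
    moreover have "p x = p y" if "e \<in> insert e0 F" "x \<in> ends e" "y \<in> ends e" for e x y
      using that True const[of e x y] uv(1) by (cases "e = e0") auto
    ultimately show ?thesis using conn' by blast
  next
    case False
    let ?K = "path_image (\<gamma> e0)"
    have st: "{pathstart (\<gamma> e0), pathfinish (\<gamma> e0)} = {p u, p v}" and "simple_path (\<gamma> e0)"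
      and im: "?K \<inter> p ` verts G = {p u, p v}"
      using dr e0(2) uv by (auto simp: drawing_def)
    then have "arc (\<gamma> e0)"
      using False by (metis arc_simple_path doubleton_eq_iff insert_absorb2)
    then obtain Q :: "complex \<Rightarrow> complex" where Q: "continuous_on UNIV Q"
      "\<And>z. Q z = 0 \<longleftrightarrow> z \<in> ?K" "inj_on Q (- ?K)"
      using collapse_arc by blast
    have "drawing (Q \<circ> p) (\<lambda>e. Q \<circ> \<gamma> e) (verts G) (edges G - insert e0 F)"
      unfolding diff
    proof (rule drawing_collapse[OF dr e0(2) _ Q])
      show "ends e \<subseteq> verts G" if "e \<in> edges G - F" for e
        using signed_graph_ends[OF G(1)] that by simp
    qed
    moreover have "(Q \<circ> p) x = (Q \<circ> p) y" if "e \<in> insert e0 F" "x \<in> ends e" "y \<in> ends e" for e x y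
    proof (cases "e \<in> F")
      case True
      then show ?thesis using const[OF True that(2,3)] by simp
    next
      case False
      then have "p x \<in> ?K" "p y \<in> ?K" using that uv(1) im by auto
      then show ?thesis using Q(2) by (metis comp_apply)
    qed
    moreover have "reach G (insert e0 F) x y"
      if xy: "x \<in> verts G" "y \<in> verts G" "(Q \<circ> p) x = (Q \<circ> p) y" for x y
    proof (cases "p x = p y")
      case True
      then show ?thesis using conn' xy by blast
    next
      case False
      have eq: "Q (p x) = Q (p y)" using xy(3) by simp
      then have "p x \<in> ?K \<longleftrightarrow> p y \<in> ?K" by (simp flip: Q(2))
      moreover have "\<not> (p x \<notin> ?K \<and> p y \<notin> ?K)"
        using inj_onD[OF Q(3) eq] False by blast
      ultimately have "p x \<in> ?K \<inter> p ` verts G" "p y \<in> ?K \<inter> p ` verts G"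
        using xy by blast+
      then have "p x \<in> {p u, p v}" "p y \<in> {p u, p v}" unfolding im .
      \<comment> \<open>The arc passes through vertices only at its ends, so \<open>x\<close> and
        \<open>y\<close> already shared their places with ends \<open>x'\<close> and
        \<open>y'\<close> of \<open>e0\<close>. A walk in \<open>F\<close>, possibly the edge
        \<open>e0\<close>, and another walk in \<open>F\<close> then join \<open>x\<close> to
        \<open>y\<close>.\<close>
      then obtain x' y' where x'y': "x' \<in> {u, v}" "y' \<in> {u, v}" "p x = p x'" "p y' = p y"
        by (metis insert_iff singletonD)
      have "reach G (insert e0 F) u v"
        using reach_edge[OF G(1) e0(1) insertI1 uv(1)] .
      then have "reach G (insert e0 F) x' y'"
        using x'y'(1,2) reach_sym[OF G(1), of _ u v] reach_refl[OF uv(2)] reach_refl[OF uv(3)]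
        by auto
      moreover have "x' \<in> verts G" "y' \<in> verts G" using x'y'(1,2) uv by auto
      then have "reach G (insert e0 F) x x'" "reach G (insert e0 F) y' y"
        using conn' x'y'(3,4) xy(1,2) by simp_all
      ultimately show ?thesis using reach_trans by metis
    qed
    ultimately show ?thesis by blast
  qed
qed

section \<open>The contracted graph and its walks\<close>

definition contract_edge :: "('a \<Rightarrow> 'b) \<Rightarrow> ('a set \<times> sign \<Rightarrow> sign) \<Rightarrow> 'a set \<times> sign \<Rightarrow> 'b set \<times> sign" where
  "contract_edge r s e = (r ` ends e, s e)"

text \<open>The map \<open>r\<close> names the classes to be merged, and \<open>s\<close> gives the
  surviving edges fresh signs. Edges that become parallel with equal new signs coincide, so again
  there is at most one edge of each sign between two vertices.\<close>

definition contract :: "'a sgraph \<Rightarrow> ('a set \<times> sign) set \<Rightarrow> ('a \<Rightarrow> 'b) \<Rightarrow> ('a set \<times> sign \<Rightarrow> sign) \<Rightarrow> 'b sgraph" where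
  "contract G J r s = \<lparr>verts = r ` verts G, edges = contract_edge r s ` (edges G - J)\<rparr>"

locale contraction =
  fixes G :: "'a sgraph" and J :: "('a set \<times> sign) set" and r :: "'a \<Rightarrow> 'b"
  assumes signed: "signed_graph G"
    and r_eq_iff: "\<And>x y. x \<in> verts G \<Longrightarrow> y \<in> verts G \<Longrightarrow> r x = r y \<longleftrightarrow> reach G J x y"
begin

lemma r_edge: "e \<in> edges G \<Longrightarrow> e \<in> J \<Longrightarrow> ends e = {x, y} \<Longrightarrow> r x = r y"
  using r_eq_iff reach_edge[OF signed] signed_graph_ends[OF signed] by (metis insert_subset)

lemma signed_graph_contract: "signed_graph (contract G J r s)"
proof -
  have "\<exists>x\<in>r ` verts G. \<exists>y\<in>r ` verts G. ends (contract_edge r s e) = {x, y}" if "e \<in> edges G" for e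
    using that signed unfolding signed_graph_def contract_edge_def by fastforce
  then show ?thesis
    using signed by (auto simp: signed_graph_def contract_def)
qed

lemma walk_project:
  "walk G x es y \<Longrightarrow> walk (contract G J r s) (r x) (map (contract_edge r s) (filter (\<lambda>e. e \<notin> J) es)) (r y)"
proof (induction es arbitrary: x)
  case Nil
  then show ?case by (auto simp: contract_def)
next
  case (Cons e es)
  then obtain z where z: "e \<in> edges G" "ends e = {x, z}" "walk G z es y" by auto
  show ?case
  proof (cases "e \<in> J")
    case True
    then show ?thesis using Cons.IH[OF z(3)] r_edge z by auto
  next
    case False
    then have "contract_edge r s e \<in> edges (contract G J r s)"
      using z(1) by (simp add: contract_def)
    moreover have "ends (contract_edge r s e) = {r x, r z}"
      using z(2) by (simp add: contract_edge_def)
    ultimately show ?thesis using Cons.IH[OF z(3)] False by auto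
  qed
qed

lemma closed_walk_project:
  "closed_walk G es \<Longrightarrow> closed_walk (contract G J r s) (map (contract_edge r s) (filter (\<lambda>e. e \<notin> J) es))"
  unfolding closed_walk_def using walk_project by blast

text \<open>Successive edges of a walk in the contraction come from edges of \<open>G\<close> that
  need not share an end, but the ends in question are joined by walks inside \<open>J\<close>.
  Inserting these fills the gaps, and the filter erases them again.\<close>

lemma walk_lift:
  assumes "walk (contract G J r s) (r x) es' w" "x \<in> verts G"
  shows "\<exists>y es. walk G x es y \<and> r y = w \<and> map (contract_edge r s) (filter (\<lambda>e. e \<notin> J) es) = es'"
  using assms
proof (induction es' arbitrary: x)
  case Nil
  then show ?case by (intro exI[of _ x] exI[of _ "[]"]) auto
next
  case (Cons e' es')
  then obtain z where z: "e' \<in> edges (contract G J r s)" "ends e' = {r x, z}"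
    "walk (contract G J r s) z es' w" by auto
  then obtain e where e: "e \<in> edges G" "e \<notin> J" "e' = contract_edge r s e"
    by (auto simp: contract_def)
  obtain a b where ab: "ends e = {a, b}"
    using signed e(1) unfolding signed_graph_def by blast
  have "{r a, r b} = {r x, z}" using z(2) e(3) ab by (simp add: contract_edge_def)
  then obtain c d where cd: "ends e = {c, d}" "r c = r x" "r d = z"
    using ab by (metis doubleton_eq_iff)
  have V: "c \<in> verts G" "d \<in> verts G"
    using signed_graph_ends[OF signed e(1)] cd(1) by auto
  obtain fs where fs: "walk G x fs c" "set fs \<subseteq> J"
    using r_eq_iff[of x c] cd V Cons.prems(2) unfolding reach_def by auto
  obtain y es where es: "walk G d es y" "r y = w" "map (contract_edge r s) (filter (\<lambda>e. e \<notin> J) es) = es'"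
    using Cons.IH[of d] z(3) cd(3) V(2) by blast
  have "walk G x (fs @ e # es) y"
    using walk_append[OF fs(1), of "e # es" y] e(1) cd(1) es(1) by auto
  moreover have "filter (\<lambda>e. e \<notin> J) fs = []"
    using fs(2) by (auto simp: filter_empty_conv)
  ultimately show ?case
    using es e by (intro exI[of _ y] exI[of _ "fs @ e # es"]) auto
qed

lemma closed_walk_lift:
  assumes "closed_walk (contract G J r s) es'"
  obtains es where "closed_walk G es" "map (contract_edge r s) (filter (\<lambda>e. e \<notin> J) es) = es'"
proof -
  obtain u where u: "walk (contract G J r s) u es' u"
    using assms by (auto simp: closed_walk_def)
  then have "u \<in> r ` verts G"
    using walk_verts[OF signed_graph_contract u] by (auto simp: contract_def)
  then obtain x where x: "x \<in> verts G" "u = r x" by auto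
  then obtain y es where es: "walk G x es y" "r y = r x" "map (contract_edge r s) (filter (\<lambda>e. e \<notin> J) es) = es'"
    using walk_lift u by blast
  \<comment> \<open>The lifted walk ends in the class of its first vertex, though perhaps at another
    vertex; one more walk inside \<open>J\<close> closes it.\<close>
  then obtain fs where fs: "walk G y fs x" "set fs \<subseteq> J"
    using r_eq_iff[of y x] x walk_verts[OF signed es(1)] unfolding reach_def by auto
  have "filter (\<lambda>e. e \<notin> J) fs = []"
    using fs(2) by (auto simp: filter_empty_conv)
  then have "map (contract_edge r s) (filter (\<lambda>e. e \<notin> J) (es @ fs)) = es'"
    using es(3) by simp
  moreover have "closed_walk G (es @ fs)"
    using walk_append[OF es(1) fs(1)] by (auto simp: closed_walk_def)
  ultimately show ?thesis using that by blast
qed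

end

text \<open>Numbering the finitely many places of the vertices in the drawing turns the
  non-injective \<open>p\<close> into an injective placement \<open>P\<close> of the merged
  vertices. Signs do not enter a drawing, so a single \<open>r\<close> serves every
  \<open>s\<close>.\<close>

lemma planar_contraction:
  fixes G :: "'a sgraph"
  assumes G: "signed_graph G" "planar G" and J: "J \<subseteq> edges G"
  obtains r :: "'a \<Rightarrow> nat" where "contraction G J r" "\<And>s. planar (contract G J r s)"
proof -
  have "finite J" using J finite_edges[OF G(1)] finite_subset by blast
  from contract_drawing[OF G this J] obtain p \<gamma> where dr: "drawing p \<gamma> (verts G) (edges G - J)"
    and rel: "\<forall>e\<in>J. \<forall>x\<in>ends e. \<forall>y\<in>ends e. p x = p y"
      "\<forall>x\<in>verts G. \<forall>y\<in>verts G. p x = p y \<longrightarrow> reach G J x y"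
    by (elim exE conjE) (rule that)
  have const: "\<And>e x y. e \<in> J \<Longrightarrow> x \<in> ends e \<Longrightarrow> y \<in> ends e \<Longrightarrow> p x = p y"
    using rel(1) by blast
  have conn: "\<And>x y. x \<in> verts G \<Longrightarrow> y \<in> verts G \<Longrightarrow> p x = p y \<Longrightarrow> reach G J x y"
    using rel(2) by blast
  have "finite (p ` verts G)" using G(1) by (simp add: signed_graph_def)
  then have cnt: "countable (p ` verts G)" by (rule countable_finite)
  define r where "r x = to_nat_on (p ` verts G) (p x)" for x
  define P where "P = from_nat_into (p ` verts G)"
  have P: "P (r x) = p x" if "x \<in> verts G" for x
    using that cnt by (simp add: P_def r_def)
  have r_eq: "r x = r y \<longleftrightarrow> p x = p y" if "x \<in> verts G" "y \<in> verts G" for x y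
    using P that by (metis r_def)
  have walk_const: "p x = p y" if "walk G x es y" "set es \<subseteq> J" for x y es
    using that by (induction es arbitrary: x) (auto dest: const)
  have con: "contraction G J r"
  proof
    fix x y assume "x \<in> verts G" "y \<in> verts G"
    then show "r x = r y \<longleftrightarrow> reach G J x y"
      using r_eq conn walk_const unfolding reach_def by metis
  qed fact
  have "planar (contract G J r s)" for s
  proof -
    let ?H = "contract G J r s"
    \<comment> \<open>Several edges of \<open>G\<close> may have merged into one edge of the
      contraction; one of them is chosen to supply its curve.\<close>
    define c where "c = inv_into (edges G - J) (contract_edge r s)"
    have c: "c e \<in> edges G - J" "contract_edge r s (c e) = e" if "e \<in> edges ?H" for e
      using that inv_into_into[of e "contract_edge r s" "edges G - J"] f_inv_into_f[of e "contract_edge r s" "edges G - J"]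
      by (simp_all add: contract_def c_def)
    have inj: "inj_on P (verts ?H)"
      using P r_eq by (auto simp: inj_on_def contract_def)
    have PV: "P ` verts ?H = p ` verts G"
      using P by (force simp: contract_def)
    have Pe: "P ` ends e = p ` ends (c e)" if "e \<in> edges ?H" for e
    proof -
      have "ends e = r ` ends (c e)" using c(2)[OF that] by (metis fst_conv contract_edge_def)
      moreover have "ends (c e) \<subseteq> verts G" using c(1)[OF that] signed_graph_ends[OF G(1)] by blast
      ultimately show ?thesis using P by (auto simp: image_image intro!: image_cong)
    qed
    have eV: "ends e \<subseteq> verts ?H" if "e \<in> edges ?H" for e
      using that signed_graph_ends contraction.signed_graph_contract[OF con] by blast
    show ?thesis
      unfolding planar_def
    proof (intro exI[of _ P] exI[of _ "\<lambda>e. \<gamma> (c e)"] conjI ballI impI)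
      show "inj_on P (verts ?H)" by fact
    next
      fix e assume e: "e \<in> edges ?H"
      show "simple_path (\<gamma> (c e))" "{pathstart (\<gamma> (c e)), pathfinish (\<gamma> (c e))} = P ` ends e"
        "path_image (\<gamma> (c e)) \<inter> P ` verts ?H = P ` ends e"
        using dr c(1)[OF e] unfolding PV Pe[OF e] drawing_def by blast+
    next
      fix e e' assume e: "e \<in> edges ?H" "e' \<in> edges ?H" "e \<noteq> e'"
      then have "c e \<noteq> c e'" using c(2) by metis
      then have "path_image (\<gamma> (c e)) \<inter> path_image (\<gamma> (c e')) = P ` ends e \<inter> P ` ends e'"
        using dr c(1) e unfolding Pe[OF e(1)] Pe[OF e(2)] drawing_def by blast
      then show "path_image (\<gamma> (c e)) \<inter> path_image (\<gamma> (c e')) = P ` (ends e \<inter> ends e')"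
        using inj_on_image_Int[OF inj] eV e by metis
    qed
  qed
  then show ?thesis using con that by blast
qed

section \<open>Homomorphisms and walk girths\<close>

lemma walk_sign_eq_iff: "walk_sign es = walk_sign fs \<longleftrightarrow> odd (num_neg es) = odd (num_neg fs)"
proof -
  have *: "walk_sign es = (if odd (num_neg es) then -1 else 1)" for es :: "('c set \<times> sign) list"
  proof (induction es)
    case (Cons e es)
    then show ?case by (cases "edge_sign e") (simp_all add: walk_sign_def num_neg_def)
  qed (simp add: walk_sign_def num_neg_def)
  show ?thesis by (simp add: *)
qed

lemma admits_homE:
  assumes "admits_hom G H"
  obtains f h where "\<And>x. x \<in> verts G \<Longrightarrow> f x \<in> verts H"
    "\<And>e. e \<in> edges G \<Longrightarrow> h e \<in> edges H" "\<And>e. e \<in> edges G \<Longrightarrow> ends (h e) = f ` ends e"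
    "\<And>es. closed_walk G es \<Longrightarrow> odd (num_neg (map h es)) = odd (num_neg es)"
proof -
  from assms[unfolded admits_hom_def walk_sign_eq_iff] obtain f h where
    "\<forall>x\<in>verts G. f x \<in> verts H" "\<forall>e\<in>edges G. h e \<in> edges H \<and> ends (h e) = f ` ends e"
    "\<forall>es. closed_walk G es \<longrightarrow> odd (num_neg (map h es)) = odd (num_neg es)"
    by (elim exE conjE) (rule that)
  then show ?thesis by (intro that[of f h]) simp_all
qed

lemma admits_homI:
  assumes "\<And>x. x \<in> verts G \<Longrightarrow> f x \<in> verts H"
    "\<And>e. e \<in> edges G \<Longrightarrow> h e \<in> edges H" "\<And>e. e \<in> edges G \<Longrightarrow> ends (h e) = f ` ends e"
    "\<And>es. closed_walk G es \<Longrightarrow> odd (num_neg (map h es)) = odd (num_neg es)"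
  shows "admits_hom G H"
  unfolding admits_hom_def walk_sign_eq_iff
  using assms by (intro exI[of _ f] exI[of _ h]) simp

lemma walk_hom:
  assumes "\<And>x. x \<in> verts G \<Longrightarrow> f x \<in> verts H"
    "\<And>e. e \<in> edges G \<Longrightarrow> h e \<in> edges H" "\<And>e. e \<in> edges G \<Longrightarrow> ends (h e) = f ` ends e"
  shows "walk G x es y \<Longrightarrow> walk H (f x) (map h es) (f y)"
proof (induction es arbitrary: x)
  case (Cons e es)
  then obtain z where "e \<in> edges G" "ends e = {x, z}" "walk G z es y" by auto
  then show ?case using Cons.IH assms(2,3) by auto
qed (use assms(1) in auto)

lemma admits_hom_trans:
  assumes "admits_hom G H" "admits_hom H K"
  shows "admits_hom G K"
proof -
  obtain f h where fh: "\<And>x. x \<in> verts G \<Longrightarrow> f x \<in> verts H"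
    "\<And>e. e \<in> edges G \<Longrightarrow> h e \<in> edges H" "\<And>e. e \<in> edges G \<Longrightarrow> ends (h e) = f ` ends e"
    "\<And>es. closed_walk G es \<Longrightarrow> odd (num_neg (map h es)) = odd (num_neg es)"
    using admits_homE[OF assms(1)] by blast
  obtain f' h' where fh': "\<And>x. x \<in> verts H \<Longrightarrow> f' x \<in> verts K"
    "\<And>e. e \<in> edges H \<Longrightarrow> h' e \<in> edges K" "\<And>e. e \<in> edges H \<Longrightarrow> ends (h' e) = f' ` ends e"
    "\<And>es. closed_walk H es \<Longrightarrow> odd (num_neg (map h' es)) = odd (num_neg es)"
    using admits_homE[OF assms(2)] by blast
  show ?thesis
  proof (rule admits_homI[of G "f' \<circ> f" K "h' \<circ> h"])
    fix es assume es: "closed_walk G es"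
    then have "closed_walk H (map h es)"
      unfolding closed_walk_def using walk_hom[of G f H h, OF fh(1-3)] by blast
    then show "odd (num_neg (map (h' \<circ> h) es)) = odd (num_neg es)"
      using fh(4)[OF es] fh'(4) by fastforce
  qed (simp_all add: fh fh' image_comp)
qed

lemma closed_walk_edges: "closed_walk G es \<Longrightarrow> set es \<subseteq> edges G"
  unfolding closed_walk_def by (elim exE) (rule walk_edges)

lemma girth_le:
  "closed_walk G es \<Longrightarrow> num_neg es mod 2 = i \<Longrightarrow> length es mod 2 = j \<Longrightarrow> girth i j G \<le> enat (length es)"
  unfolding girth_def by (intro INF_lower) auto

lemma le_girthI:
  assumes "\<And>es. closed_walk G es \<Longrightarrow> num_neg es mod 2 = i \<Longrightarrow> length es mod 2 = j \<Longrightarrow> b \<le> enat (length es)"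
  shows "b \<le> girth i j G"
  unfolding girth_def using assms by (intro INF_greatest) auto

lemma num_neg_contract_edge:
  "(\<And>e. e \<in> set es \<Longrightarrow> s e = edge_sign e) \<Longrightarrow> num_neg (map (contract_edge r s) es) = num_neg es"
  by (induction es) (auto simp: num_neg_def contract_edge_def)

text \<open>Contracting nothing relabels the vertices by natural numbers.\<close>

lemma nat_copy:
  fixes G :: "'a sgraph"
  assumes "SP m G"
  obtains H :: "nat sgraph" where "SP m H" "admits_hom G H"
proof -
  have G: "signed_graph G" "planar G" using assms by (auto simp: SP_def)
  obtain r :: "'a \<Rightarrow> nat" where "contraction G {} r" and pl: "\<And>s. planar (contract G {} r s)"
    using planar_contraction[OF G, of "{}"] by auto
  then interpret contraction G "{}" r by simp
  let ?H = "contract G {} r edge_sign"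
  have "girth i j G \<le> girth i j ?H" for i j
  proof (rule le_girthI)
    fix es' assume es': "closed_walk ?H es'" "num_neg es' mod 2 = i" "length es' mod 2 = j"
    obtain es where es: "closed_walk G es" "map (contract_edge r edge_sign) (filter (\<lambda>e. e \<notin> {}) es) = es'"
      using closed_walk_lift[OF es'(1)] .
    then have "num_neg es' = num_neg es" "length es' = length es"
      using num_neg_contract_edge[of es edge_sign r] by auto
    then show "girth i j G \<le> enat (length es')"
      using girth_le[OF es(1)] es' by metis
  qed
  then have "SP m ?H"
    using assms pl signed_graph_contract unfolding SP_def by (meson order_trans)
  moreover have "admits_hom G ?H"
  proof (rule admits_homI[of G r ?H "contract_edge r edge_sign"])
    show "odd (num_neg (map (contract_edge r edge_sign) es)) = odd (num_neg es)" for es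
      using num_neg_contract_edge[of es edge_sign r] by simp
  qed (auto simp: contract_def contract_edge_def)
  ultimately show ?thesis using that by blast
qed

text \<open>Going once round the cycle is a closed walk of length \<open>m\<close> with a single
  negative edge.\<close>

lemma neg_cycle_girth_odd: "1 \<le> m \<Longrightarrow> girth 1 (m mod 2) (neg_cycle m) \<le> enat m"
proof -
  assume m: "1 \<le> m"
  define c where "c i = ({i, Suc i mod m}, if Suc i = m then Neg else Pos)" for i
  have "edges (neg_cycle m) = c ` {i. i < m}"
    unfolding neg_cycle_def c_def by (simp add: setcompr_eq_image)
  then have c: "c i \<in> edges (neg_cycle m)" if "i < m" for i
    using that by blast
  \<comment> \<open>The walk grows backwards from its last vertex. Writing the start as
    \<open>i mod m\<close> lets \<open>i = m\<close> stand for vertex 0, the empty rest of the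
    tour.\<close>
  have "walk (neg_cycle m) (i mod m) (map c [i..<m]) 0" if "i \<le> m" for i
    using that
  proof (induction rule: inc_induct)
    case base
    then show ?case using m by (simp add: neg_cycle_def)
  next
    case (step i)
    moreover have "ends (c i) = {i, Suc i mod m}" by (simp add: c_def)
    ultimately have "walk (neg_cycle m) i (c i # map c [Suc i..<m]) 0"
      using c[of i] by auto
    then show ?case using step by (simp add: upt_conv_Cons)
  qed
  from this[of 0] have "closed_walk (neg_cycle m) (map c [0..<m])"
    unfolding closed_walk_def by auto
  moreover have "num_neg (map c [0..<m]) = 1"
  proof -
    have "num_neg (map c [0..<m]) = length (filter (\<lambda>i. Suc i = m) [0..<m])"
      by (simp add: num_neg_def filter_map comp_def c_def)
    also have "\<dots> = card {i. i < m \<and> Suc i = m}"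
      by (simp add: length_filter_conv_card cong: conj_cong)
    also have "{i. i < m \<and> Suc i = m} = {m - 1}" using m by auto
    finally show ?thesis by simp
  qed
  ultimately show ?thesis using girth_le by fastforce
qed

text \<open>The empty walk is closed at any vertex, so a nonempty negative cycle imposes only the
  bound 0 on positive closed walks of even length.\<close>

lemma girth_0_0: "verts G \<noteq> {} \<Longrightarrow> girth 0 0 G = 0"
proof -
  assume "verts G \<noteq> {}"
  then have "closed_walk G []" by (auto simp: closed_walk_def)
  from girth_le[OF this, of 0 0] show ?thesis by (simp add: num_neg_def zero_enat_def[symmetric])
qed

section \<open>Contracting the negative class and lifting to the double cover\<close>

text \<open>Over the two-element field a difference is the indicator of the coordinates where two
  vectors disagree. In this form the condition is symmetric in the ends, as suits edges given by
  unordered sets.\<close>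

lemma SPC_edge:
  assumes "e \<in> edges (SPC l)" "ends e = {u, v}"
  shows "edge_sign e = Pos \<and> (\<exists>j<l. \<forall>n. u n \<noteq> v n \<longleftrightarrow> n = j) \<or>
         edge_sign e = Neg \<and> (\<forall>n. u n \<noteq> v n \<longleftrightarrow> n < l)"
proof -
  have delta: "(\<lambda>n. x n - y n) = (\<lambda>n. if P n then 1 else 0) \<longleftrightarrow> (\<forall>n. x n \<noteq> y n \<longleftrightarrow> P n)"
    for x y :: "nat \<Rightarrow> bit" and P
  proof -
    have "a - b = (if q then 1 else 0) \<longleftrightarrow> (a \<noteq> b \<longleftrightarrow> q)" for a b :: bit and q
      by (cases a; cases b) auto
    then show ?thesis by (simp add: fun_eq_iff)
  qed
  have "(\<exists>x y. e = ({x, y}, Pos) \<and> (\<exists>j<l. \<forall>n. x n \<noteq> y n \<longleftrightarrow> n = j)) \<or>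
        (\<exists>x y. e = ({x, y}, Neg) \<and> (\<forall>n. x n \<noteq> y n \<longleftrightarrow> n < l))"
    using assms(1) unfolding SPC_def Let_def delta by auto
  then show ?thesis
  proof (elim disjE exE conjE)
    fix x y j assume e: "e = ({x, y}, Pos)" and j: "j < l" "\<forall>n. (x n \<noteq> y n) = (n = j)"
    then have "x = u \<and> y = v \<or> x = v \<and> y = u" using assms(2) by (auto simp: doubleton_eq_iff)
    then have "\<forall>n. (u n \<noteq> v n) = (n = j)" using j(2) by metis
    then show ?thesis using e j(1) by auto
  next
    fix x y assume e: "e = ({x, y}, Neg)" and d: "\<forall>n. (x n \<noteq> y n) = (n < l)"
    then have "x = u \<and> y = v \<or> x = v \<and> y = u" using assms(2) by (auto simp: doubleton_eq_iff)
    then have "\<forall>n. (u n \<noteq> v n) = (n < l)" using d by metis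
    then show ?thesis using e by auto
  qed
qed

lemma SPC_contraction:
  fixes G :: "'a sgraph"
  assumes G: "signed_graph G" "planar G" and l: "1 \<le> l" and hom: "admits_hom G (SPC l)"
  obtains J and r :: "'a \<Rightarrow> nat" and s where
    "contraction G J r" "SP l (contract G J r s)"
    "\<And>es. closed_walk G es \<Longrightarrow> odd (length (filter (\<lambda>e. e \<in> J) es)) = odd (num_neg es)"
    "\<And>es. closed_walk G es \<Longrightarrow> odd (num_neg (map (contract_edge r s) (filter (\<lambda>e. e \<notin> J) es))) = odd (num_neg es)"
proof -
  obtain f h where "\<And>x. x \<in> verts G \<Longrightarrow> f x \<in> verts (SPC l)"
    and h: "\<And>e. e \<in> edges G \<Longrightarrow> h e \<in> edges (SPC l)" "\<And>e. e \<in> edges G \<Longrightarrow> ends (h e) = f ` ends e"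
    and sgn: "\<And>es. closed_walk G es \<Longrightarrow> odd (num_neg (map h es)) = odd (num_neg es)"
    using admits_homE[OF hom] by blast
  define J where "J = {e \<in> edges G. edge_sign (h e) = Neg}"
  \<comment> \<open>These are the edges mapped to coordinate direction \<open>n\<close>. An edge
    does not order its ends, hence the quantified \<open>x\<close> and \<open>y\<close>;
    \<open>dirn_iff\<close> shows that any naming of the ends gives the same answer.\<close>
  define dirn where "dirn n e \<longleftrightarrow> e \<notin> J \<and> (\<exists>x y. ends e = {x, y} \<and> f x n \<noteq> f y n)" for n e
  have edge: "e \<notin> J \<and> (\<exists>j<l. \<forall>n. f x n \<noteq> f y n \<longleftrightarrow> n = j) \<or> e \<in> J \<and> (\<forall>n. f x n \<noteq> f y n \<longleftrightarrow> n < l)"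
    if "e \<in> edges G" "ends e = {x, y}" for e x y
    using SPC_edge[OF h(1), of e "f x" "f y"] h(2)[of e] that by (auto simp: J_def)
  have dirn_iff: "dirn n e \<longleftrightarrow> e \<notin> J \<and> f x n \<noteq> f y n" if "ends e = {x, y}" for n e x y
  proof -
    have "f x' n \<noteq> f y' n \<longleftrightarrow> f x n \<noteq> f y n" if "ends e = {x', y'}" for x' y'
      using that \<open>ends e = {x, y}\<close> by (metis doubleton_eq_iff)
    then show ?thesis unfolding dirn_def using that by blast
  qed
  \<comment> \<open>An edge changes coordinate \<open>n\<close> exactly if it has direction
    \<open>n\<close> or lies in \<open>J\<close>, since negative edges of \<open>SPC l\<close>
    change all \<open>l\<close> coordinates. On a closed walk the coordinate returns to its value,
    so both classes occur with equal parity.\<close>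
  have walk_parity: "f x n \<noteq> f y n \<longleftrightarrow>
      odd (length (filter (dirn n) es)) \<noteq> odd (length (filter (\<lambda>e. e \<in> J) es))"
    if "walk G x es y" "n < l" for x es y n
    using that(1)
  proof (induction es arbitrary: x)
    case (Cons e es)
    then obtain z where z: "e \<in> edges G" "ends e = {x, z}" "walk G z es y" by auto
    have "f x n \<noteq> f z n \<longleftrightarrow> dirn n e \<or> e \<in> J"
      using edge[OF z(1,2)] dirn_iff[OF z(2), of n] that(2) by auto
    moreover have "\<not> (dirn n e \<and> e \<in> J)" unfolding dirn_def by blast
    moreover have "f x n \<noteq> f y n \<longleftrightarrow> ((f x n \<noteq> f z n) \<noteq> (f z n \<noteq> f y n))"
      by (cases "f x n"; cases "f z n"; cases "f y n") auto
    ultimately show ?case using Cons.IH[OF z(3)] by auto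
  qed simp
  have J_parity: "odd (length (filter (\<lambda>e. e \<in> J) es)) = odd (num_neg es)" if "closed_walk G es" for es
  proof -
    have "set es \<subseteq> edges G" using that by (rule closed_walk_edges)
    then have "num_neg (map h es) = length (filter (\<lambda>e. e \<in> J) es)"
      by (induction es) (auto simp: num_neg_def J_def)
    then show ?thesis using sgn[OF that] by simp
  qed
  have dirn_parity: "odd (length (filter (dirn n) es)) = odd (num_neg es)"
    if "closed_walk G es" "n < l" for es n
    using that walk_parity[of _ es _ n] J_parity[of es] unfolding closed_walk_def by blast
  \<comment> \<open>Each edge outside \<open>J\<close> has exactly one of the \<open>l\<close>
    directions.\<close>
  have length_eq: "length (filter (\<lambda>e. e \<notin> J) es) = (\<Sum>n<l. length (filter (dirn n) es))"
    if "set es \<subseteq> edges G" for es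
    using that
  proof (induction es)
    case (Cons e es)
    obtain x y where xy: "ends e = {x, y}" using G(1) Cons.prems unfolding signed_graph_def by auto
    have "(\<Sum>n<l. if dirn n e then 1 else 0) = (if e \<in> J then 0 else 1 :: nat)"
    proof (cases "e \<in> J")
      case False
      then obtain j where j: "j < l" "\<forall>n. f x n \<noteq> f y n \<longleftrightarrow> n = j"
        using edge[OF _ xy] Cons.prems by auto
      then have "dirn n e \<longleftrightarrow> n = j" for n using dirn_iff[OF xy] False by simp
      then show ?thesis using j(1) False by (simp add: sum.delta)
    qed (simp add: dirn_def)
    moreover have "length (filter (dirn n) (e # es)) =
        (if dirn n e then 1 else 0) + length (filter (dirn n) es)" for n by simp
    ultimately show ?case using Cons by (simp add: sum.distrib del: filter.simps) auto
  qed simp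
  \<comment> \<open>Direction 0 exists because \<open>1 \<le> l\<close>. Making it negative gives
    each closed walk of the contraction the sign of its lifts to \<open>G\<close>, by
    \<open>dirn_parity\<close>.\<close>
  define s where "s e = (if dirn 0 e then Neg else Pos)" for e
  obtain r :: "'a \<Rightarrow> nat" where "contraction G J r" and pl: "\<And>s. planar (contract G J r s)"
    using planar_contraction[OF G, of J] by (auto simp: J_def)
  then interpret contraction G J r by simp
  let ?H = "contract G J r s"
  have num_neg_H: "num_neg (map (contract_edge r s) (filter (\<lambda>e. e \<notin> J) es)) = length (filter (dirn 0) es)" for es
    by (induction es) (auto simp: num_neg_def contract_edge_def s_def dirn_def)
  have girth: "girth i j (neg_cycle l) \<le> girth i j ?H" for i j
  proof (rule le_girthI)
    fix es' assume es': "closed_walk ?H es'" "num_neg es' mod 2 = i" "length es' mod 2 = j"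
    obtain es where es: "closed_walk G es" "map (contract_edge r s) (filter (\<lambda>e. e \<notin> J) es) = es'"
      using closed_walk_lift[OF es'(1)] .
    have "set es \<subseteq> edges G" using es(1) by (rule closed_walk_edges)
    then have len: "length es' = (\<Sum>n<l. length (filter (dirn n) es))"
      using length_eq es(2) by (metis length_map)
    have neg: "odd (num_neg es') = odd (num_neg es)"
      using num_neg_H es dirn_parity[of es 0] l by auto
    show "girth i j (neg_cycle l) \<le> enat (length es')"
    proof (cases "odd (num_neg es)")
      case True
      \<comment> \<open>On a negative closed walk all \<open>l\<close> directions occur an odd
        number of times. So its length is a sum of \<open>l\<close> odd numbers: at least
        \<open>l\<close> and of the parity of \<open>l\<close>, as for the tour of the negative
        cycle.\<close>
      then have odd: "odd (length (filter (dirn n) es))" if "n < l" for n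
        using dirn_parity[OF es(1) that] by simp
      have "(\<Sum>n<l. 1) \<le> length es'"
        unfolding len
      proof (rule sum_mono)
        show "1 \<le> length (filter (dirn n) es)" if "n \<in> {..<l}" for n
          using odd_pos[OF odd[of n]] that by (simp add: Suc_le_eq)
      qed
      moreover have "{n \<in> {..<l}. odd (length (filter (dirn n) es))} = {..<l}"
        using odd by auto
      then have "even (length es') = even l"
        unfolding len by (subst even_sum_iff) auto
      then have "j = l mod 2" using es'(3) by presburger
      moreover have "i = 1" using True neg es'(2) by presburger
      ultimately show ?thesis
        using neg_cycle_girth_odd[OF l] by (auto intro: order_trans)
    next
      case False
      \<comment> \<open>A positive closed walk uses every direction an even number of times, so its
        length is even and it is compared with the empty walk.\<close>
      then have "even (length es')"
        unfolding len using dirn_parity[OF es(1)] by (intro dvd_sum) auto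
      then have "i = 0" "j = 0" using False neg es'(2,3) by presburger+
      moreover have "0 \<in> verts (neg_cycle l)" using l by (simp add: neg_cycle_def)
      then have "verts (neg_cycle l) \<noteq> {}" by blast
      ultimately show ?thesis using girth_0_0[of "neg_cycle l"] by simp
    qed
  qed
  have "SP l ?H"
    using girth pl signed_graph_contract unfolding SP_def by simp
  moreover have "odd (num_neg (map (contract_edge r s) (filter (\<lambda>e. e \<notin> J) es))) = odd (num_neg es)"
    if "closed_walk G es" for es
    using num_neg_H dirn_parity[OF that] l by simp
  ultimately show ?thesis
    using that contraction_axioms J_parity by blast
qed

text \<open>The value at \<open>x\<close> is the parity of \<open>P\<close>-edges on a chosen walk
  to \<open>x\<close> from the base vertex of its component. For an edge, the chosen walks to its
  two ends and the edge itself form a closed walk, where the parity is even.\<close>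

lemma potential:
  assumes G: "signed_graph G"
    and even: "\<And>es. closed_walk G es \<Longrightarrow> even (length (filter P es))"
  shows "\<exists>a :: 'a \<Rightarrow> bool. \<forall>e\<in>edges G. \<forall>x y. ends e = {x, y} \<longrightarrow> (a x \<noteq> a y \<longleftrightarrow> P e)"
proof -
  \<comment> \<open>The predicate under \<open>SOME\<close> depends only on the component of
    \<open>x\<close>, so the two ends of an edge receive the same base vertex.\<close>
  define b where "b x = (SOME y. reach G UNIV y x)" for x
  define w where "w x = (SOME es. walk G (b x) es x)" for x
  define a where "a x = odd (length (filter P (w x)))" for x
  have w: "walk G (b x) (w x) x" if "x \<in> verts G" for x
  proof -
    have "reach G UNIV (b x) x"
      unfolding b_def using reach_refl[OF that] by (rule someI)
    then show ?thesis
      unfolding w_def reach_def by (metis (no_types, lifting) someI_ex)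
  qed
  have "a x \<noteq> a y \<longleftrightarrow> P e" if e: "e \<in> edges G" "ends e = {x, y}" for e x y
  proof -
    have V: "x \<in> verts G" "y \<in> verts G" using signed_graph_ends[OF G e(1)] e(2) by auto
    have "reach G UNIV x y" using reach_edge[OF G e(1)] e(2) by simp
    then have "reach G UNIV z x \<longleftrightarrow> reach G UNIV z y" for z
      using reach_trans reach_sym[OF G] by metis
    then have "b x = b y" by (simp add: b_def)
    then have "walk G y (rev (w y)) (b x)"
      using walk_rev[OF G w[OF V(2)]] by simp
    then have "walk G x (e # rev (w y)) (b x)"
      using e by auto
    then have "walk G (b x) (w x @ e # rev (w y)) (b x)"
      by (rule walk_append[OF w[OF V(1)]])
    then have "closed_walk G (w x @ e # rev (w y))"
      unfolding closed_walk_def by blast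
    from even[OF this] show ?thesis
      by (auto simp: a_def rev_filter[symmetric] split: if_splits)
  qed
  then show ?thesis by (intro exI[of _ a]) simp
qed

text \<open>Edges of \<open>J\<close> go to the negative edges joining the two copies of a vertex,
  all others to positive edges above their images in \<open>B\<close>. The sign of a closed walk is
  then preserved by \<open>J_parity\<close>.\<close>

lemma lift_to_EDC:
  fixes G :: "'a sgraph" and B :: "'b sgraph" and r :: "'a \<Rightarrow> 'c"
  assumes con: "contraction G J r" and hom: "admits_hom (contract G J r s) B"
    and J_parity: "\<And>es. closed_walk G es \<Longrightarrow> odd (length (filter (\<lambda>e. e \<in> J) es)) = odd (num_neg es)"
    and s_parity: "\<And>es. closed_walk G es \<Longrightarrow>
      odd (num_neg (map (contract_edge r s) (filter (\<lambda>e. e \<notin> J) es))) = odd (num_neg es)"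
  shows "admits_hom G (EDC B)"
proof -
  interpret contraction G J r by fact
  let ?H = "contract G J r s"
  obtain f h where f: "\<And>x. x \<in> verts ?H \<Longrightarrow> f x \<in> verts B"
    and h: "\<And>e. e \<in> edges ?H \<Longrightarrow> h e \<in> edges B" "\<And>e. e \<in> edges ?H \<Longrightarrow> ends (h e) = f ` ends e"
    and sgn: "\<And>es. closed_walk ?H es \<Longrightarrow> odd (num_neg (map h es)) = odd (num_neg es)"
    using admits_homE[OF hom] by blast
  \<comment> \<open>These edges have to switch between the two copies. On a closed walk the edges of
    \<open>J\<close> and those with negative image in \<open>B\<close> each have the parity of
    \<open>num_neg es\<close>, so together they are even in number.\<close>
  define P where "P e \<longleftrightarrow> e \<in> J \<or> edge_sign (h (contract_edge r s e)) = Neg" for e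
  have even: "even (length (filter P es))" if es: "closed_walk G es" for es
  proof -
    let ?es' = "map (contract_edge r s) (filter (\<lambda>e. e \<notin> J) es)"
    have "length (filter P es) = length (filter (\<lambda>e. e \<in> J) es) + num_neg (map h ?es')"
      by (induction es) (auto simp: P_def num_neg_def)
    then show ?thesis
      using J_parity[OF es] s_parity[OF es] sgn[OF closed_walk_project[OF es]] by auto
  qed
  obtain a :: "'a \<Rightarrow> bool" where "\<forall>e\<in>edges G. \<forall>x y. ends e = {x, y} \<longrightarrow> (a x \<noteq> a y \<longleftrightarrow> P e)"
    using potential[OF signed even] ..
  then have a: "a x \<noteq> a y \<longleftrightarrow> P e" if "e \<in> edges G" "ends e = {x, y}" for e x y
    using that by simp
  define F where "F x = (f (r x), of_bool (a x) :: bit)" for x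
  have lvl: "of_bool (\<not> q) = of_bool q + (1::bit)" for q by (cases q) auto
  show ?thesis
  proof (rule admits_homI[of G F "EDC B" "\<lambda>e. (F ` ends e, if e \<in> J then Neg else Pos)"])
    show "F x \<in> verts (EDC B)" if "x \<in> verts G" for x
      using f[of "r x"] that by (auto simp: EDC_def F_def contract_def)
  next
    fix e assume e: "e \<in> edges G"
    then obtain x y where xy: "ends e = {x, y}" "x \<in> verts G"
      using signed unfolding signed_graph_def by blast
    show "(F ` ends e, if e \<in> J then Neg else Pos) \<in> edges (EDC B)"
    proof (cases "e \<in> J")
      case True
      \<comment> \<open>Contraction gives both ends the same image in \<open>B\<close>, and the
        potential puts them in different copies.\<close>
      then have "r x = r y" "a x \<noteq> a y"
        using r_edge[OF e _ xy(1)] a[OF e xy(1)] by (auto simp: P_def)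
      then have "F ` ends e = {(f (r x), 0), (f (r x), 1)}"
        using xy by (cases "a x") (auto simp: F_def)
      moreover have "f (r x) \<in> verts B" using f xy(2) by (simp add: contract_def)
      ultimately show ?thesis using True by (auto simp: EDC_def)
    next
      case False
      let ?e = "h (contract_edge r s e)"
      have "contract_edge r s e \<in> edges ?H" using e False by (simp add: contract_def)
      then have "?e \<in> edges B" "ends ?e = {f (r x), f (r y)}"
        using h[of "contract_edge r s e"] xy by (auto simp: contract_edge_def)
      then have B: "({f (r x), f (r y)}, edge_sign ?e) \<in> edges B" by (metis prod.collapse)
      have Fe: "F ` ends e = {F x, F y}" using xy by simp
      show ?thesis
      proof (cases "edge_sign ?e")
        case Pos
        then have "a x = a y" using a[OF e xy(1)] False by (auto simp: P_def)
        then show ?thesis using B Pos False unfolding Fe by (auto simp: EDC_def F_def)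
      next
        case Neg
        then have "a y = (\<not> a x)" using a[OF e xy(1)] False by (auto simp: P_def)
        then have "F y = (f (r y), of_bool (a x) + 1)" by (simp only: F_def lvl)
        then have "{F x, F y} = {(f (r x), of_bool (a x)), (f (r y), of_bool (a x) + 1)}"
          by (simp only: F_def)
        moreover have "({f (r x), f (r y)}, Neg) \<in> edges B" using B Neg by simp
        ultimately have "(F ` ends e, Pos) \<in>
            {({(u, c), (v, c + 1)}, Pos) | u v c. ({u, v}, Neg) \<in> edges B}"
          unfolding Fe by blast
        then show ?thesis using False by (simp add: EDC_def del: add_bit_eq_xor)
      qed
    qed
  next
    fix es assume es: "closed_walk G es"
    have "num_neg (map (\<lambda>e. (F ` ends e, if e \<in> J then Neg else Pos)) es) = length (filter (\<lambda>e. e \<in> J) es)"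
      by (induction es) (auto simp: num_neg_def)
    then show "odd (num_neg (map (\<lambda>e. (F ` ends e, if e \<in> J then Neg else Pos)) es)) = odd (num_neg es)"
      using J_parity[OF es] by simp
  qed simp
qed

theorem mainTheorem8:
  fixes k l :: nat and B :: "'b sgraph"
  assumes "k \<ge> 1"
    and "\<forall>i. 1 \<le> i \<and> i \<le> k \<longrightarrow> (\<forall>G :: nat sgraph. SP (i + 1) G \<longrightarrow> admits_hom G (SPC i))"
    and "1 \<le> l" and "l \<le> k"
    and "signed_graph B"
    and "\<forall>G :: nat sgraph. SP l G \<longrightarrow> admits_hom G B"
  shows "\<forall>G :: 'a sgraph. SP (l + 1) G \<longrightarrow> admits_hom G (EDC B)"
proof (intro allI impI)
  fix G :: "'a sgraph" assume SP: "SP (l + 1) G"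
  \<comment> \<open>The hypotheses concern graphs on natural numbers, so \<open>G\<close> is first
    replaced by a copy \<open>N\<close> of that type. The hypothesis on \<open>SPC\<close> is then
    applied with \<open>i = l\<close>.\<close>
  obtain N :: "nat sgraph" where "SP (l + 1) N" "admits_hom G N"
    using nat_copy[OF SP] .
  then have hom: "admits_hom G (SPC l)"
    using assms(2-4) admits_hom_trans by blast
  have G: "signed_graph G" "planar G" using SP by (auto simp: SP_def)
  show "admits_hom G (EDC B)"
  proof (rule SPC_contraction[OF G assms(3) hom])
    fix J s and r :: "'a \<Rightarrow> nat"
    assume con: "contraction G J r" and SP_l: "SP l (contract G J r s)"
      and parity: "\<And>es. closed_walk G es \<Longrightarrow> odd (length (filter (\<lambda>e. e \<in> J) es)) = odd (num_neg es)"
        "\<And>es. closed_walk G es \<Longrightarrow> odd (num_neg (map (contract_edge r s) (filter (\<lambda>e. e \<notin> J) es))) = odd (num_neg es)"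
    have "admits_hom (contract G J r s) B"
      using assms(6) SP_l by blast
    then show ?thesis
      by (rule lift_to_EDC[OF con]) (fact parity)+
  qed
qed

end
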